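(* Let $\eta>0$, $\theta\in\mathbb{R}$, $\sigma>0$, and let $\beta>0$ be even. Let $X$ be a random variable with the generalized Gaussian-type probability density function $$f_X(x;\eta,\beta,\theta,\sigma)=\frac{\beta}{2\sigma}\frac{\eta^{1/\beta}}{\Gamma(1/\beta)}\exp\left(-\eta\left(\frac{x-\theta}{\sigma}\right)^\beta\right),\qquad x\in\mathbb{R}.$$ Then the distribution function $F_X$ of $X$ is given by $$F_X(x;\eta,\beta,\theta,\sigma)=\frac{1}{2}\Bigl[1-\frac{\beta}{\sigma}\frac{\eta^{1/\beta}}{\Gamma(1/\beta)}\left(\frac{x-\theta}{\sigma}\right)\exp\left(-\eta\left(\frac{x-\theta}{\sigma}\right)^\beta\right)\;{}_1F_1\left(1;\frac{\beta+1}{\beta}; \eta\left(\frac{x-\theta}{\sigma}\right)^{\beta}\right)\Bigr],$$ and the $n$th moments $M(X^n)$ of $X$ are given by $$M(X^n)=\int_{-\infty}^{+\infty} x^n f_X(x;\eta,\beta,\theta,\sigma)\,dx=\frac{\theta^n}{\Gamma(1/\beta)}\sum_{\substack{l\ge0\\ 2l\le n}}\Gamma\left(\frac{2l+1}{\beta}\right)C_{2l}^n\left(\frac{\sigma}{\theta\,\eta^{1/\beta}}\right)^{2l},$$ where $l$ runs over nonnegative integers and $C_{2l}^n=\frac{n!}{(n-2l)!\,(2l)!}$. Thus the mean and the variance of $X$ are respectively $$EX=M(X^1)=\theta\quad\text{and}\quad \operatorname{var}X=EX^2-(EX)^2=\frac{\sigma^2}{\eta^{2/\beta}}\frac{\Gamma(3/\beta)}{\Gamma(1/\beta)}.$$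 Moreover, if $\eta\ge1/2$ and $\beta>2$, then $$\operatorname{var}X=\frac{\sigma^2}{\eta^{2/\beta}}\frac{\Gamma(3/\beta)}{\Gamma(1/\beta)}\le\sigma^2,$$ where $\sigma^2$ is the variance of the Gaussian random variable (the case $\beta=2$, $\eta=1/2$).
   Context: ${}_1F_1(a;b;x)=\sum_{n=0}^{\infty}\frac{(a)_n}{(b)_n}\frac{x^n}{n!}$, where $(\vartheta)_n=\Gamma(\vartheta+n)/\Gamma(\vartheta)$, $(\vartheta)_0=1$ (Pochhammer symbol). The distribution function is $F_X(x)=\int_{-\infty}^x f_X(u)\,du$.
   Formalization: In the formula for F_X the minus sign after 1 is corrected to plus and the prefactor β/σ to β (the printed formula fails for every x ≠ θ); the moment formula as printed is stated for θ ≠ 0, and with the powers of θ combined as θ^{n-2l} for all θ. *)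

theory Defs
  imports "HOL-Probability.Probability"
begin

definition hyp_1F1 :: "real \<Rightarrow> real \<Rightarrow> real \<Rightarrow> real" where
  "hyp_1F1 a b x = (\<Sum>n. pochhammer a n / pochhammer b n * (x ^ n / fact n))"

text \<open>
  The exponent \<open>\<beta>\<close> is a natural number, since it is meant to be even; this makes the
  power well defined at negative arguments.
\<close>

definition gen_gauss_density :: "real \<Rightarrow> nat \<Rightarrow> real \<Rightarrow> real \<Rightarrow> real \<Rightarrow> real" where
  "gen_gauss_density \<eta> \<beta> \<theta> \<sigma> x =
     real \<beta> / (2 * \<sigma>) * (\<eta> powr (1 / real \<beta>) / Gamma (1 / real \<beta>)) *
     exp (- \<eta> * ((x - \<theta>) / \<sigma>) ^ \<beta>)"

end

theory Submission
  imports Defs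
begin

text \<open>
  After the substitution \<open>z = (x - \<theta>) / \<sigma>\<close> everything reduces to the kernel
  \<open>exp (- \<eta> * z ^ \<beta>)\<close>. Its even moments over the half line become Gamma integrals via
  \<open>t = \<eta> * z ^ \<beta>\<close>, and its odd moments vanish; the moments of \<open>X\<close> follow by the binomial theorem.
  With \<open>w = \<eta> * z ^ \<beta>\<close>, the function \<open>z * exp (- w) * hyp_1F1 1 (1 + 1 / \<beta>) w\<close> is a primitive of
  the kernel, by the first-order differential equation for \<open>hyp_1F1 1 b\<close>; this gives the
  distribution function. For the variance bound write \<open>u = 1 / \<beta> \<le> 1 / 4\<close>; log-convexity of Gamma
  gives \<open>Gamma (1 + 3 * u) \<le> 1\<close> and \<open>Gamma (1 + u) \<ge> 1 / 2\<close>, so that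
  \<open>Gamma (3 * u) / Gamma u \<le> 2 / 3 \<le> (1 / 2) powr (2 * u)\<close>.
\<close>

section \<open>The function 1F1(1; b; w) and the primitive of the kernel\<close>

lemma fact_le_pochhammer:
  fixes b :: real
  assumes "b \<ge> 1"
  shows "fact n \<le> pochhammer b n"
proof (induction n)
  case (Suc n)
  have "(1 + real n) * fact n \<le> (b + real n) * pochhammer b n"
    using assms Suc by (intro mult_mono) auto
  then show ?case
    by (simp add: pochhammer_Suc algebra_simps)
qed simp

text \<open>The exponential series is a majorant, because b \<ge> 1 makes every Pochhammer symbol at
  least the factorial.\<close>

lemma summable_power_divide_pochhammer:
  fixes b w :: real
  assumes "b \<ge> 1"
  shows "summable (\<lambda>n. 1 / pochhammer b n * w ^ n)"
proof (rule summable_comparison_test'[OF summable_exp[of "\<bar>w\<bar>"]])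
  fix n
  have "0 < (fact n :: real)" "fact n \<le> pochhammer b n"
    using fact_le_pochhammer[OF assms] by auto
  then have "1 / pochhammer b n * \<bar>w\<bar> ^ n \<le> inverse (fact n) * \<bar>w\<bar> ^ n"
    by (intro mult_right_mono) (auto simp: inverse_eq_divide intro!: frac_le)
  then show "norm (1 / pochhammer b n * w ^ n) \<le> inverse (fact n) * \<bar>w\<bar> ^ n"
    using pochhammer_pos[of b n] assms by (simp add: abs_mult power_abs)
qed

text \<open>The factorial cancels against \<open>pochhammer 1 n\<close>, which leaves an ordinary
  power series that can be differentiated term by term.\<close>

lemma hyp_1F1_one: "hyp_1F1 1 b w = (\<Sum>n. 1 / pochhammer b n * w ^ n)"
  by (simp add: hyp_1F1_def flip: pochhammer_fact)

text \<open>
  The coefficients \<open>a n = 1 / pochhammer b n\<close> satisfy \<open>(b + n) * a (n + 1) = a n\<close>, which is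
  the differential equation \<open>w * y' + (b - 1) * y = (b - 1) + w * y\<close>.
\<close>
lemma hyp_1F1_one_ODE:
  fixes b w :: real
  assumes b: "b \<ge> 1"
  obtains D where "(hyp_1F1 1 b has_real_derivative D) (at w)"
    "w * D + (b - 1) * hyp_1F1 1 b w = (b - 1) + w * hyp_1F1 1 b w"
proof -
  define a where "a n = 1 / pochhammer b n" for n
  have a_Suc: "(b + real n) * a (Suc n) = a n" for n
    using b by (simp add: a_def pochhammer_Suc)
  have hyp: "hyp_1F1 1 b = (\<lambda>w. \<Sum>n. a n * w ^ n)"
    by (simp add: fun_eq_iff hyp_1F1_one a_def)
  have sm: "summable (\<lambda>n. a n * v ^ n)" for v
    using summable_power_divide_pochhammer[OF b] by (simp add: a_def)
  define D where "D = (\<Sum>n. diffs a n * w ^ n)"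
  have "(\<lambda>n. diffs a n * w ^ n) sums D"
    unfolding D_def by (intro summable_sums termdiff_converges_all sm)
  then have D: "(\<lambda>n. w * (diffs a n * w ^ n)) sums (w * D)"
    by (rule sums_mult)
  have S: "(\<lambda>n. a n * w ^ n) sums hyp_1F1 1 b w"
    unfolding hyp by (intro summable_sums sm)
  \<comment> \<open>The nth term of w * D has degree n + 1, so the series itself is shifted by one
    to match. The dropped constant term \<open>a 0 = 1\<close> is the source of the inhomogeneous b
    - 1 in the equation.\<close>
  have "(\<lambda>n. a (Suc n) * w ^ Suc n) sums (hyp_1F1 1 b w - a 0 * w ^ 0)"
    by (subst sums_Suc_iff) (use S in simp)
  then have T: "(\<lambda>n. (b - 1) * (a (Suc n) * w ^ Suc n)) sums ((b - 1) * (hyp_1F1 1 b w - 1))"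
    by (intro sums_mult) (simp add: a_def)
  have "w * (diffs a n * w ^ n) + (b - 1) * (a (Suc n) * w ^ Suc n) = w * (a n * w ^ n)" for n
  proof -
    have "w * (diffs a n * w ^ n) + (b - 1) * (a (Suc n) * w ^ Suc n)
        = w * (((b + real n) * a (Suc n)) * w ^ n)"
      by (simp add: diffs_def algebra_simps)
    then show ?thesis by (simp add: a_Suc)
  qed
  then have "(\<lambda>n. w * (a n * w ^ n)) sums (w * D + (b - 1) * (hyp_1F1 1 b w - 1))"
    using sums_add[OF D T] by simp
  then have "w * hyp_1F1 1 b w = w * D + (b - 1) * (hyp_1F1 1 b w - 1)"
    using sums_mult[OF S] sums_unique2 by blast
  moreover have "(hyp_1F1 1 b has_real_derivative D) (at w)"
    unfolding hyp D_def by (intro termdiffs_strong_converges_everywhere sm)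
  ultimately show ?thesis
    by (intro that) (auto simp: algebra_simps)
qed

text \<open>Put w = \<eta> z^\<beta>, so that z w' = \<beta> w, and let h be the value of 1F1 at w,
  with derivative D. The product rule gives exp (-w) times h + \<beta> (w D - w h). The parameter b
  is the one with \<beta> (b - 1) = 1, so the differential equation turns the second summand into 1
  - h.\<close>

lemma has_real_derivative_gen_gauss_primitive:
  fixes \<eta> z :: real and \<beta> :: nat
  assumes "\<beta> > 0"
  defines "b \<equiv> (real \<beta> + 1) / real \<beta>"
  shows "((\<lambda>z. z * exp (- \<eta> * z ^ \<beta>) * hyp_1F1 1 b (\<eta> * z ^ \<beta>))
           has_real_derivative exp (- \<eta> * z ^ \<beta>)) (at z)"
proof -
  have b: "b \<ge> 1" "real \<beta> * (b - 1) = 1"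
    using assms by (auto simp: field_simps)
  define w where "w = \<eta> * z ^ \<beta>"
  obtain D where D: "(hyp_1F1 1 b has_real_derivative D) (at w)"
    and ode: "w * D + (b - 1) * hyp_1F1 1 b w = (b - 1) + w * hyp_1F1 1 b w"
    using hyp_1F1_one_ODE[OF b(1)] by blast
  define w' where "w' = \<eta> * (real \<beta> * z ^ (\<beta> - 1))"
  have zw': "z * w' = real \<beta> * w"
    using \<open>\<beta> > 0\<close> by (cases \<beta>) (auto simp: w'_def w_def)
  have dw: "((\<lambda>z. \<eta> * z ^ \<beta>) has_real_derivative w') (at z)"
    unfolding w'_def by (auto intro!: derivative_eq_intros simp: mult_ac)
  have dh: "((\<lambda>z. hyp_1F1 1 b (\<eta> * z ^ \<beta>)) has_real_derivative D * w') (at z)"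
    by (rule DERIV_chain2[OF _ dw]) (use D in \<open>simp add: w_def\<close>)
  have de: "((\<lambda>z. exp (- (\<eta> * z ^ \<beta>))) has_real_derivative - w' * exp (- w)) (at z)"
    by (auto intro!: derivative_eq_intros simp: w_def w'_def)
  have "((\<lambda>z. z * exp (- (\<eta> * z ^ \<beta>)) * hyp_1F1 1 b (\<eta> * z ^ \<beta>)) has_real_derivative
          (exp (- w) * (hyp_1F1 1 b w + (z * w') * (D - hyp_1F1 1 b w)))) (at z)"
    by (rule derivative_eq_intros dh de refl)+ (simp add: w_def algebra_simps)
  also have "(z * w') * (D - hyp_1F1 1 b w) = real \<beta> * (w * D - w * hyp_1F1 1 b w)"
    unfolding zw' by (simp add: algebra_simps)
  also have "w * D - w * hyp_1F1 1 b w = (b - 1) * (1 - hyp_1F1 1 b w)"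
    using ode by (simp add: algebra_simps)
  also have "real \<beta> * ((b - 1) * (1 - hyp_1F1 1 b w)) = 1 - hyp_1F1 1 b w"
    using b(2) by (simp flip: mult.assoc)
  finally show ?thesis
    by (simp add: w_def)
qed

section \<open>Moments and incomplete integral of the kernel\<close>

text \<open>The substitution t = \<eta> z^\<beta> carries the Gamma integral at s into \<beta>
  \<eta>^s times the integral sought.\<close>

lemma has_bochner_integral_power_exp_halfline:
  fixes \<eta> :: real and \<beta> m :: nat
  assumes "\<eta> > 0" "\<beta> > 0"
  defines "s \<equiv> (real m + 1) / real \<beta>"
  shows "has_bochner_integral lborel (\<lambda>z. indicator {0..} z *\<^sub>R (z ^ m * exp (- \<eta> * z ^ \<beta>)))
           (Gamma s / (real \<beta> * \<eta> powr s))"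
proof -
  have s: "s > 0" using assms by (simp add: s_def)
  have sb: "real \<beta> * s = real m + 1" using assms by (simp add: s_def)
  define g where "g z = \<eta> * z ^ \<beta>" for z :: real
  define g' where "g' z = \<eta> * (real \<beta> * z ^ (\<beta> - 1))" for z :: real
  define f where "f t = t powr (s - 1) / exp t" for t :: real
  have deriv: "(g has_real_derivative g' z) (at z within {0<..})" for z
    unfolding g_def g'_def by (auto intro!: derivative_eq_intros)
  have inj: "inj_on g {0<..}"
    using assms by (auto simp: inj_on_def g_def power_eq_iff_eq_base)
  have img: "g ` {0<..} = {0<..}"
  proof (intro equalityI subsetI)
    fix t :: real assume t: "t \<in> {0<..}"
    have "(t / \<eta>) = ((t / \<eta>) powr (1 / real \<beta>)) ^ \<beta>"
      using t assms by (simp add: powr_power)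
    then have "t = g ((t / \<eta>) powr (1 / real \<beta>))"
      using assms by (simp add: g_def field_simps)
    moreover have "(t / \<eta>) powr (1 / real \<beta>) \<in> {0<..}" using t assms by auto
    ultimately show "t \<in> g ` {0<..}" by blast
  qed (use assms in \<open>auto simp: g_def\<close>)
  have "(f has_integral Gamma s) {0..}"
    unfolding f_def using Gamma_integral_real[OF s] .
  \<comment> \<open>The endpoint is a null set; without it all powers of z can be written with
    \<open>powr\<close>.\<close>
  then have f: "(f has_integral Gamma s) {0<..}"
    by (rule has_integral_spike_set_eq[THEN iffD1, rotated 2]) (auto intro: negligible_subset[of "{0}"])
  have "f absolutely_integrable_on {0<..}"
    using f by (intro nonnegative_absolutely_integrable_1) (auto simp: f_def)
  then have sub: "(\<lambda>z. \<bar>g' z\<bar> * f (g z)) absolutely_integrable_on {0<..}"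
    "integral {0<..} (\<lambda>z. \<bar>g' z\<bar> * f (g z)) = Gamma s"
    using has_absolute_integral_change_of_variables_1'[OF _ deriv inj, of f "Gamma s"] f
    by (auto simp: img integral_unique)
  then have "((\<lambda>z. \<bar>g' z\<bar> * f (g z)) has_integral Gamma s) {0<..}"
    using absolutely_integrable_on_def has_integral_iff by blast
  \<comment> \<open>Exponents of z: (\<beta> - 1) + \<beta> (s - 1) = m, since \<beta> s = m +
    1.\<close>
  moreover have "\<bar>g' z\<bar> * f (g z) = (real \<beta> * \<eta> powr s) * (z ^ m * exp (- \<eta> * z ^ \<beta>))"
    if z: "z \<in> {0<..}" for z
  proof -
    have z: "z > 0" using z by simp
    have g: "g z = \<eta> * z powr real \<beta>"
      using z by (simp add: g_def powr_realpow)
    have "\<bar>g' z\<bar> = \<eta> * real \<beta> * z powr (real \<beta> - 1)"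
      using z assms by (simp add: g'_def powr_realpow of_nat_diff flip: powr_realpow)
    moreover have "g z powr (s - 1) = \<eta> powr (s - 1) * z powr (real m + 1 - real \<beta>)"
      using z assms unfolding g by (simp add: powr_mult powr_powr right_diff_distrib sb)
    moreover have "z powr (real \<beta> - 1) * z powr (real m + 1 - real \<beta>) = z ^ m"
      using z by (simp flip: powr_add add: powr_realpow)
    moreover have "\<eta> * \<eta> powr (s - 1) = \<eta> powr s"
      using assms by (simp add: powr_diff)
    ultimately have "\<bar>g' z\<bar> * g z powr (s - 1) = real \<beta> * \<eta> powr s * z ^ m"
      by (metis (no_types, lifting) mult.assoc mult.commute mult.left_commute)
    then show ?thesis
      by (simp add: f_def g_def exp_minus field_simps)
  qed
  ultimately have "((\<lambda>z. (real \<beta> * \<eta> powr s) * (z ^ m * exp (- \<eta> * z ^ \<beta>))) has_integral Gamma s) {0<..}"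
    by (subst (asm) has_integral_cong) auto
  from has_integral_mult_right[OF this, of "1 / (real \<beta> * \<eta> powr s)"]
  have "((\<lambda>z. z ^ m * exp (- \<eta> * z ^ \<beta>)) has_integral Gamma s / (real \<beta> * \<eta> powr s)) {0<..}"
    using assms by simp
  then have *: "((\<lambda>z. z ^ m * exp (- \<eta> * z ^ \<beta>)) has_integral Gamma s / (real \<beta> * \<eta> powr s)) {0..}"
    by (rule has_integral_spike_set_eq[THEN iffD1, rotated 2]) (auto intro: negligible_subset[of "{0}"])
  \<comment> \<open>Nonnegativity turns the gauge integral into a Lebesgue integral; its finite
    value then gives Bochner integrability.\<close>
  have "integral\<^sup>N lborel (\<lambda>z. indicator {0..} z * (z ^ m * exp (- \<eta> * z ^ \<beta>)))
      = Gamma s / (real \<beta> * \<eta> powr s)"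
    by (rule nn_integral_has_integral_lebesgue[OF _ *]) auto
  then show ?thesis
    using assms s by (intro has_bochner_integral_nn_integral)
      (auto intro!: AE_I2 Gamma_real_nonneg divide_nonneg_nonneg simp: indicator_def)
qed

text \<open>An even \<beta> makes the kernel even, so the integrand inherits the parity of
  m.\<close>

lemma has_bochner_integral_power_exp:
  fixes \<eta> :: real and \<beta> m :: nat
  assumes "\<eta> > 0" "\<beta> > 0" "even \<beta>"
  defines "s \<equiv> (real m + 1) / real \<beta>"
  shows "has_bochner_integral lborel (\<lambda>z. z ^ m * exp (- \<eta> * z ^ \<beta>))
           (if even m then 2 * (Gamma s / (real \<beta> * \<eta> powr s)) else 0)"
proof (cases "even m")
  case True
  then show ?thesis
    using has_bochner_integral_even_function
      [OF has_bochner_integral_power_exp_halfline[OF assms(1,2), of m]] assms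
    by simp
next
  case False
  then show ?thesis
    using has_bochner_integral_odd_function
      [OF has_bochner_integral_power_exp_halfline[OF assms(1,2), of m]] assms
    by simp
qed

text \<open>\<open>?I\<close> is the mass of the kernel on the negative half line and
  \<open>?F\<close> its primitive with value 0 at 0. The integral up to z is therefore
  \<open>?I + ?F z\<close> for either sign of z.\<close>

lemma has_bochner_integral_exp_atMost:
  fixes \<eta> z :: real and \<beta> :: nat
  assumes "\<eta> > 0" "\<beta> > 0" "even \<beta>"
  shows "has_bochner_integral lborel (\<lambda>u. indicator {..z} u * exp (- \<eta> * u ^ \<beta>))
           (Gamma (1 / real \<beta>) / (real \<beta> * \<eta> powr (1 / real \<beta>)) +
            z * exp (- \<eta> * z ^ \<beta>) * hyp_1F1 1 ((real \<beta> + 1) / real \<beta>) (\<eta> * z ^ \<beta>))"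
    (is "has_bochner_integral _ _ (?I + ?F z)")
proof -
  let ?f = "\<lambda>u. exp (- \<eta> * u ^ \<beta>)"
  have "(\<lambda>u. indicator {..0} u * ?f u) = (\<lambda>u. indicator {0..} (- u) *\<^sub>R ((- u) ^ 0 * ?f (- u)))"
    using assms by (auto split: split_indicator)
  then have neg: "has_bochner_integral lborel (\<lambda>u. indicator {..0} u * ?f u) ?I"
    using has_bochner_integral_power_exp_halfline[OF assms(1,2), of 0]
      lborel_has_bochner_integral_real_affine_iff[of "- 1"
        "\<lambda>u. indicator {0..} u *\<^sub>R (u ^ 0 * ?f u)" ?I 0]
    by simp
  have FTC: "has_bochner_integral lborel (\<lambda>u. ?f u * indicator {a..b} u) (?F b - ?F a)"
    if "a \<le> b" for a b
    using that assms(2) has_real_derivative_gen_gauss_primitive[of \<beta> \<eta>]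
    by (intro has_bochner_integral_FTC_Icc_real) (auto intro!: continuous_intros)
  show ?thesis
  proof (cases "z \<ge> 0")
    case True
    have "has_bochner_integral lborel
        (\<lambda>u. indicator {..0} u * ?f u + ?f u * indicator {0..z} u) (?I + (?F z - ?F 0))"
      by (rule has_bochner_integral_add[OF neg FTC[OF True]])
    \<comment> \<open>The sum counts the point 0 twice, which does not affect the integral.\<close>
    then have "has_bochner_integral lborel
        (\<lambda>u. indicator {..z} u * ?f u) (?I + (?F z - ?F 0))"
      by (rule has_bochner_integral_discrete_difference[where X="{0}", THEN iffD1, rotated 4])
        (use True in \<open>auto split: split_indicator\<close>)
    then show ?thesis by simp
  next
    case False
    then have "has_bochner_integral lborel
        (\<lambda>u. indicator {..0} u * ?f u - ?f u * indicator {z..0} u) (?I - (?F 0 - ?F z))"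
      by (intro has_bochner_integral_diff[OF neg FTC]) auto
    \<comment> \<open>Here the difference of the indicators misses only the point z.\<close>
    then have "has_bochner_integral lborel
        (\<lambda>u. indicator {..z} u * ?f u) (?I - (?F 0 - ?F z))"
      by (rule has_bochner_integral_discrete_difference[where X="{z}", THEN iffD1, rotated 4])
        (use False in \<open>auto split: split_indicator\<close>)
    then show ?thesis by simp
  qed
qed

section \<open>Bounds for Gamma and for the ratio in the variance\<close>

text \<open>The convex function ln Gamma vanishes at 1 and at 2, hence is at most 0 in
  between.\<close>

lemma Gamma_real_le_1:
  fixes x :: real
  assumes "1 \<le> x" "x \<le> 2"
  shows "Gamma x \<le> 1"
proof -
  have "ln (Gamma x) \<le> 0"
    using convex_onD[OF log_convex_Gamma_real, of "x - 1" 1 2] assms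
    by (simp add: algebra_simps Gamma_numeral)
  moreover have "Gamma x > 0" using assms by (intro Gamma_real_pos) auto
  ultimately show ?thesis by simp
qed

text \<open>Convexity is used at 2, a point between x and 3: with 2 = (1 - t) x + 3 t it gives 0
  \<le> (1 - t) ln (Gamma x) + t ln 2. From x \<ge> 1 follows t \<le> 1 - t, so ln (Gamma x) \<ge> -
  ln 2.\<close>

lemma Gamma_real_ge_half:
  fixes x :: real
  assumes "1 \<le> x" "x \<le> 2"
  shows "Gamma x \<ge> 1 / 2"
proof -
  have pos: "Gamma x > 0" using assms by (intro Gamma_real_pos) auto
  define t where "t = (2 - x) / (3 - x)"
  have t: "0 \<le> t" "t \<le> 1 / 2" using assms by (auto simp: t_def field_simps)
  have "(1 - t) * x + t * 3 = 2"
    using assms by (simp add: t_def diff_divide_distrib[symmetric] divide_simps)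
  then have "0 \<le> (1 - t) * ln (Gamma x) + t * ln 2"
    using convex_onD[OF log_convex_Gamma_real, of t x 3] t assms
    by (simp add: Gamma_numeral numeral_2_eq_2)
  moreover have "t * ln 2 \<le> (1 - t) * ln (2 :: real)"
    using t by (intro mult_right_mono) auto
  ultimately have "0 \<le> (1 - t) * (ln (Gamma x) + ln 2)"
    unfolding distrib_left by linarith
  then have "0 \<le> ln (Gamma x) + ln 2"
    using t by (simp add: zero_le_mult_iff)
  also have "\<dots> = ln (Gamma x * 2)"
    using pos by (simp add: ln_mult)
  finally show ?thesis
    using pos by simp
qed

text \<open>The functional equation moves u and 3 u to the arguments 1 + u and 1 + 3 u in [1, 2],
  where both bounds apply.\<close>

lemma Gamma_triple_ratio_le_1:
  fixes u \<eta> :: real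
  assumes "0 < u" "u \<le> 1 / 4" "\<eta> \<ge> 1 / 2"
  shows "1 / \<eta> powr (2 * u) * (Gamma (3 * u) / Gamma u) \<le> 1"
proof -
  have G: "Gamma (1 + u) = u * Gamma u" "Gamma (1 + 3 * u) = 3 * u * Gamma (3 * u)"
    using assms Gamma_plus1[of u] Gamma_plus1[of "3 * u"]
      nonpos_Ints_nonpos[of u] nonpos_Ints_nonpos[of "3 * u"]
    by (auto simp: add.commute)
  have pos: "Gamma u > 0" "Gamma (3 * u) > 0" using assms by auto
  have "3 * u * Gamma (3 * u) \<le> 1"
    using Gamma_real_le_1[of "1 + 3 * u"] assms G by auto
  moreover have "1 / 2 \<le> u * Gamma u"
    using Gamma_real_ge_half[of "1 + u"] assms G by auto
  ultimately have "3 * u * Gamma (3 * u) \<le> 2 * (u * Gamma u)" by linarith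
  then have ratio: "Gamma (3 * u) / Gamma u \<le> 2 / 3"
    using assms pos by (simp add: field_simps)
  have "\<eta> powr (2 * u) \<ge> (1 / 2) powr (2 * u)"
    using assms by (intro powr_mono2) auto
  \<comment> \<open>The base is below 1, so the power decreases in the exponent, and 2 u \<le> 1 /
    2.\<close>
  moreover have "(1 / 2) powr (2 * u) \<ge> (1 / 2 :: real) powr (1 / 2)"
    using assms by (intro powr_mono') auto
  \<comment> \<open>Squaring reduces this to 4 / 9 \<le> 1 / 2.\<close>
  moreover have "(1 / 2 :: real) powr (1 / 2) \<ge> 2 / 3"
    by (subst powr_half_sqrt, simp, rule real_le_rsqrt, simp add: power2_eq_square)
  ultimately have "2 / 3 \<le> \<eta> powr (2 * u)" by linarith
  then have "Gamma (3 * u) / Gamma u \<le> \<eta> powr (2 * u)"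
    using ratio by linarith
  then show ?thesis
    using assms pos by (simp add: pos_divide_le_eq)
qed


section \<open>Transfer to the density by x = \<theta> + \<sigma> z\<close>

lemma gen_gauss_density_nonneg:
  assumes "\<sigma> > 0" "\<beta> > 0"
  shows "0 \<le> gen_gauss_density \<eta> \<beta> \<theta> \<sigma> x"
  using assms by (simp add: gen_gauss_density_def Gamma_real_nonneg)

lemma gen_gauss_density_affine:
  assumes "\<sigma> > 0"
  shows "gen_gauss_density \<eta> \<beta> \<theta> \<sigma> (\<theta> + \<sigma> * z) =
    real \<beta> / (2 * \<sigma>) * (\<eta> powr (1 / real \<beta>) / Gamma (1 / real \<beta>)) * exp (- \<eta> * z ^ \<beta>)"
  using assms by (simp add: gen_gauss_density_def)

text \<open>The mass left of \<theta> contributes the 1 / 2. The primitive enters with sign plus,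
  and the Jacobian \<sigma> cancels the 1 / \<sigma> of the density.\<close>

lemma has_bochner_integral_gen_gauss_density_atMost:
  assumes "\<eta> > 0" "\<sigma> > 0" "\<beta> > 0" "even \<beta>"
  shows "has_bochner_integral lborel (\<lambda>u. indicator {..x} u *\<^sub>R gen_gauss_density \<eta> \<beta> \<theta> \<sigma> u)
    (1 / 2 * (1 + real \<beta> * (\<eta> powr (1 / real \<beta>) / Gamma (1 / real \<beta>)) *
           ((x - \<theta>) / \<sigma>) * exp (- \<eta> * ((x - \<theta>) / \<sigma>) ^ \<beta>) *
           hyp_1F1 1 ((real \<beta> + 1) / real \<beta>) (\<eta> * ((x - \<theta>) / \<sigma>) ^ \<beta>)))"
    (is "has_bochner_integral _ _ ?R")
proof -
  define z where "z = (x - \<theta>) / \<sigma>"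
  define C where "C = real \<beta> / (2 * \<sigma>) * (\<eta> powr (1 / real \<beta>) / Gamma (1 / real \<beta>))"
  \<comment> \<open>Variables stand for the \<open>powr\<close> and \<open>Gamma\<close> values, so
    that the algebra needs only their positivity. The division by \<bar>\<sigma>\<bar> comes from
    the affine substitution.\<close>
  have aux: "real \<beta> / (2 * \<sigma>) * (e / G) * (G / (real \<beta> * e) + z * E * H)
      = (1 / 2 * (1 + real \<beta> * (e / G) * z * E * H)) /\<^sub>R \<bar>\<sigma>\<bar>"
    if "G > 0" "e > 0" for e G E H
    using that assms by (simp add: field_simps)
  have R: "C * (Gamma (1 / real \<beta>) / (real \<beta> * \<eta> powr (1 / real \<beta>)) +
      z * exp (- \<eta> * z ^ \<beta>) * hyp_1F1 1 ((real \<beta> + 1) / real \<beta>) (\<eta> * z ^ \<beta>)) = ?R /\<^sub>R \<bar>\<sigma>\<bar>"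
    unfolding C_def z_def[symmetric] by (rule aux) (use assms in auto)
  have "indicator {..x} (\<theta> + \<sigma> * u) = (indicator {..z} u :: real)" for u
    using assms by (auto simp: z_def field_simps split: split_indicator)
  then have "(\<lambda>u. indicator {..x} (\<theta> + \<sigma> * u) *\<^sub>R gen_gauss_density \<eta> \<beta> \<theta> \<sigma> (\<theta> + \<sigma> * u))
      = (\<lambda>u. C * (indicator {..z} u * exp (- \<eta> * u ^ \<beta>)))"
    unfolding gen_gauss_density_affine[OF assms(2)] C_def by (simp add: mult_ac)
  then show ?thesis
    using has_bochner_integral_mult_right[OF has_bochner_integral_exp_atMost[OF assms(1,3,4), of z], of C]
      lborel_has_bochner_integral_real_affine_iff[of \<sigma>
        "\<lambda>u. indicator {..x} u *\<^sub>R gen_gauss_density \<eta> \<beta> \<theta> \<sigma> u" ?R \<theta>] assms(2)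
    unfolding R by simp
qed

text \<open>The power (\<theta> + \<sigma> z)^n is expanded binomially; only even powers of z
  survive. Keeping \<theta>^(n - 2 l) avoids a division by \<theta>, so \<theta> = 0 is
  covered.\<close>

lemma has_bochner_integral_gen_gauss_density_moment:
  assumes "\<eta> > 0" "\<sigma> > 0" "\<beta> > 0" "even \<beta>"
  shows "has_bochner_integral lborel (\<lambda>x. x ^ n * gen_gauss_density \<eta> \<beta> \<theta> \<sigma> x)
    (1 / Gamma (1 / real \<beta>) *
         (\<Sum>l | 2 * l \<le> n. Gamma ((2 * real l + 1) / real \<beta>) * real (n choose (2 * l)) *
            \<theta> ^ (n - 2 * l) * (\<sigma> / \<eta> powr (1 / real \<beta>)) ^ (2 * l)))"
    (is "has_bochner_integral _ _ ?R")
proof -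
  define e where "e = \<eta> powr (1 / real \<beta>)"
  define C where "C = real \<beta> / (2 * \<sigma>) * (e / Gamma (1 / real \<beta>))"
  define J where "J m = (if even m then 2 * (Gamma ((real m + 1) / real \<beta>)
      / (real \<beta> * \<eta> powr ((real m + 1) / real \<beta>))) else 0)" for m
  define a where "a k = C * (real (n choose k) * \<sigma> ^ k * \<theta> ^ (n - k))" for k
  have e: "e > 0" using assms by (simp add: e_def)
  have G: "Gamma (1 / real \<beta>) > 0" using assms by auto
  \<comment> \<open>The single factor e cancels against the normalising constant; e^m joins
    \<sigma>^m.\<close>
  have e_pow: "\<eta> powr ((real m + 1) / real \<beta>) = e * e ^ m" for m
  proof -
    have "e * e ^ m = e powr (real m + 1)"
      using e by (simp add: powr_add powr_realpow)
    then show ?thesis by (simp add: e_def powr_powr)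
  qed
  have "has_bochner_integral lborel (\<lambda>z. \<Sum>k\<le>n. a k * (z ^ k * exp (- \<eta> * z ^ \<beta>))) (\<Sum>k\<le>n. a k * J k)"
    unfolding J_def
    by (intro has_bochner_integral_sum has_bochner_integral_mult_right has_bochner_integral_power_exp assms)
  also have "(\<lambda>z. \<Sum>k\<le>n. a k * (z ^ k * exp (- \<eta> * z ^ \<beta>)))
      = (\<lambda>z. (\<theta> + \<sigma> * z) ^ n * gen_gauss_density \<eta> \<beta> \<theta> \<sigma> (\<theta> + \<sigma> * z))"
  proof
    fix z
    show "(\<Sum>k\<le>n. a k * (z ^ k * exp (- \<eta> * z ^ \<beta>)))
        = (\<theta> + \<sigma> * z) ^ n * gen_gauss_density \<eta> \<beta> \<theta> \<sigma> (\<theta> + \<sigma> * z)"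
      unfolding gen_gauss_density_affine[OF assms(2)]
      unfolding add.commute[of \<theta>] binomial_ring
      by (simp add: a_def C_def e_def sum_distrib_left sum_distrib_right sum_divide_distrib power_mult_distrib mult_ac)
  qed
  also have "(\<Sum>k\<le>n. a k * J k) = (\<Sum>k | k \<le> n \<and> even k. a k * J k)"
    by (rule sum.mono_neutral_right) (auto simp: J_def)
  also have "{k. k \<le> n \<and> even k} = (\<lambda>l. 2 * l) ` {l. 2 * l \<le> n}"
    by (auto elim!: evenE)
  also have "(\<Sum>k\<in>(\<lambda>l. 2 * l) ` {l. 2 * l \<le> n}. a k * J k) = (\<Sum>l | 2 * l \<le> n. a (2 * l) * J (2 * l))"
    by (subst sum.reindex) (auto simp: inj_on_def)
  also have "\<dots> = ?R /\<^sub>R \<bar>\<sigma>\<bar>"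
    unfolding sum_distrib_left scaleR_sum_right
  proof (rule sum.cong[OF refl])
    fix l
    have "J (2 * l) = 2 * Gamma ((2 * real l + 1) / real \<beta>) / (real \<beta> * (e * e ^ (2 * l)))"
      using e_pow[of "2 * l"] by (simp add: J_def)
    then have "a (2 * l) * J (2 * l) = 1 / Gamma (1 / real \<beta>) * (Gamma ((2 * real l + 1) / real \<beta>) *
        real (n choose (2 * l)) * \<theta> ^ (n - 2 * l) * (\<sigma> ^ (2 * l) / e ^ (2 * l))) / \<sigma>"
      using assms e G by (simp add: a_def C_def mult_ac)
    then show "a (2 * l) * J (2 * l) = (1 / Gamma (1 / real \<beta>) * (Gamma ((2 * real l + 1) / real \<beta>) *
        real (n choose (2 * l)) * \<theta> ^ (n - 2 * l) * (\<sigma> / \<eta> powr (1 / real \<beta>)) ^ (2 * l))) /\<^sub>R \<bar>\<sigma>\<bar>"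
      using assms by (simp add: power_divide e_def power_mult_distrib divide_inverse mult_ac flip: power_inverse)
  qed
  finally show ?thesis
    using lborel_has_bochner_integral_real_affine_iff[of \<sigma>
        "\<lambda>x. x ^ n * gen_gauss_density \<eta> \<beta> \<theta> \<sigma> x" ?R \<theta>] assms(2) by simp
qed

section \<open>The Gaussian case\<close>

text \<open>With Gamma (1 / 2) = sqrt pi, the normalising constant becomes 1 / (\<sigma> sqrt (2
  pi)).\<close>

lemma gen_gauss_density_half_2:
  assumes "\<sigma> > 0"
  shows "gen_gauss_density (1 / 2) 2 \<theta> \<sigma> = normal_density \<theta> \<sigma>"
proof
  fix x
  have "(1 / 2 :: real) powr (1 / 2) = 1 / sqrt 2"
    by (simp add: powr_half_sqrt real_sqrt_divide)
  then show "gen_gauss_density (1 / 2) 2 \<theta> \<sigma> x = normal_density \<theta> \<sigma> x"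
    using assms by (simp add: gen_gauss_density_def normal_density_def Gamma_one_half_real
        real_sqrt_mult power_divide)
qed

lemma variance_normal_density:
  assumes "\<sigma> > 0"
  shows "prob_space.variance (density lborel (normal_density \<theta> \<sigma>)) (\<lambda>x. x) = \<sigma> ^ 2"
proof -
  interpret prob_space "density lborel (normal_density \<theta> \<sigma>)"
    using assms by (rule prob_space_normal_density)
  have "distributed (density lborel (normal_density \<theta> \<sigma>)) lborel (\<lambda>x. x) (normal_density \<theta> \<sigma>)"
    by (auto simp: distributed_def distr_id2)
  then show ?thesis
    using assms by (rule normal_distributed_variance[rotated])
qed

section \<open>Distribution function, moments and variance of X\<close>

text \<open>The distribution function has a plus sign and no factor 1 / \<sigma>, unlike the formula
  in the English statement: a minus sign would make it decrease, and an extra 1 / \<sigma> would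
  spoil the limit 1 at infinity unless \<sigma> = 1. Integrability is part of the conclusion because
  a Bochner integral that does not exist is 0 by default. The moment formula that divides by
  \<theta> is guarded: with x / 0 = 0 it would give 0 at \<theta> = 0 for every n > 0, which is
  false for even n. The other form covers all \<theta>.\<close>

theorem corollary2:
  fixes M :: "'a measure" and X :: "'a \<Rightarrow> real"
    and \<eta> \<theta> \<sigma> :: real and \<beta> :: nat
  assumes "prob_space M"
    and "\<eta> > 0" and "\<sigma> > 0" and "\<beta> > 0" and "even \<beta>"
    and "distributed M lborel X (gen_gauss_density \<eta> \<beta> \<theta> \<sigma>)"
  shows
    "(\<forall>x. set_integrable lborel {..x} (gen_gauss_density \<eta> \<beta> \<theta> \<sigma>) \<and>
       cdf (distr M lborel X) x = (LBINT u:{..x}. gen_gauss_density \<eta> \<beta> \<theta> \<sigma> u) \<and>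
       cdf (distr M lborel X) x =
         1 / 2 * (1 + real \<beta> * (\<eta> powr (1 / real \<beta>) / Gamma (1 / real \<beta>)) *
           ((x - \<theta>) / \<sigma>) * exp (- \<eta> * ((x - \<theta>) / \<sigma>) ^ \<beta>) *
           hyp_1F1 1 ((real \<beta> + 1) / real \<beta>) (\<eta> * ((x - \<theta>) / \<sigma>) ^ \<beta>))) \<and>
     (\<forall>n. integrable M (\<lambda>\<omega>. X \<omega> ^ n) \<and>
       integrable lborel (\<lambda>x. x ^ n * gen_gauss_density \<eta> \<beta> \<theta> \<sigma> x) \<and>
       prob_space.expectation M (\<lambda>\<omega>. X \<omega> ^ n) =
         (LBINT x. x ^ n * gen_gauss_density \<eta> \<beta> \<theta> \<sigma> x) \<and>
       (\<theta> \<noteq> 0 \<longrightarrow>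
         prob_space.expectation M (\<lambda>\<omega>. X \<omega> ^ n) =
           \<theta> ^ n / Gamma (1 / real \<beta>) *
           (\<Sum>l | 2 * l \<le> n. Gamma ((2 * real l + 1) / real \<beta>) * real (n choose (2 * l)) *
              (\<sigma> / (\<theta> * \<eta> powr (1 / real \<beta>))) ^ (2 * l))) \<and>
       prob_space.expectation M (\<lambda>\<omega>. X \<omega> ^ n) =
         1 / Gamma (1 / real \<beta>) *
         (\<Sum>l | 2 * l \<le> n. Gamma ((2 * real l + 1) / real \<beta>) * real (n choose (2 * l)) *
            \<theta> ^ (n - 2 * l) * (\<sigma> / \<eta> powr (1 / real \<beta>)) ^ (2 * l))) \<and>
     prob_space.expectation M X = \<theta> \<and>
     prob_space.variance M X =
       prob_space.expectation M (\<lambda>\<omega>. X \<omega> ^ 2) - (prob_space.expectation M X) ^ 2 \<and>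
     prob_space.variance M X =
       \<sigma> ^ 2 / \<eta> powr (2 / real \<beta>) * (Gamma (3 / real \<beta>) / Gamma (1 / real \<beta>)) \<and>
     (\<eta> \<ge> 1 / 2 \<and> \<beta> > 2 \<longrightarrow>
       prob_space.variance M X \<le> \<sigma> ^ 2) \<and>
     gen_gauss_density (1 / 2) 2 \<theta> \<sigma> = normal_density \<theta> \<sigma> \<and>
     prob_space.variance (density lborel (gen_gauss_density (1 / 2) 2 \<theta> \<sigma>)) (\<lambda>x. x) = \<sigma> ^ 2"
proof -
  interpret prob_space M by fact
  let ?f = "gen_gauss_density \<eta> \<beta> \<theta> \<sigma>"
  note pos = assms(2-5) and D = assms(6)
  have nonneg: "0 \<le> ?f x" for x
    using pos by (intro gen_gauss_density_nonneg)
  have [measurable]: "X \<in> borel_measurable M"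
    using distributed_measurable[OF D] by simp
  have cdf: "set_integrable lborel {..x} ?f"
    "cdf (distr M lborel X) x = (LBINT u:{..x}. ?f u)" for x
  proof -
    have "has_bochner_integral lborel (\<lambda>u. ?f u * indicator {..x} u) (LBINT u:{..x}. ?f u)"
      using has_bochner_integral_gen_gauss_density_atMost[OF pos, of x \<theta>]
      by (simp add: has_bochner_integral_iff set_lebesgue_integral_def mult.commute)
    then show "set_integrable lborel {..x} ?f"
      by (simp add: has_bochner_integral_iff set_integrable_def mult.commute)
    have "(LBINT u:{..x}. ?f u) = (\<integral>u. ?f u * indicator {..x} u \<partial>lborel)"
      by (simp add: set_lebesgue_integral_def mult.commute)
    \<comment> \<open>The expectation formula for a density, applied to the indicator of {..x},
      yields the probability of X \<le> x.\<close>
    also have "\<dots> = expectation (\<lambda>\<omega>. indicator {..x} (X \<omega>))"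
      by (rule distributed_integral[OF D]) (auto simp: nonneg)
    also have "\<dots> = expectation (indicator (X -` {..x} \<inter> space M))"
      by (intro Bochner_Integration.integral_cong) (auto split: split_indicator)
    also have "\<dots> = cdf (distr M lborel X) x"
      by (simp add: cdf_def measure_distr)
    finally show "cdf (distr M lborel X) x = (LBINT u:{..x}. ?f u)" ..
  qed
  have cdf_eq: "(LBINT u:{..x}. ?f u) =
         1 / 2 * (1 + real \<beta> * (\<eta> powr (1 / real \<beta>) / Gamma (1 / real \<beta>)) *
           ((x - \<theta>) / \<sigma>) * exp (- \<eta> * ((x - \<theta>) / \<sigma>) ^ \<beta>) *
           hyp_1F1 1 ((real \<beta> + 1) / real \<beta>) (\<eta> * ((x - \<theta>) / \<sigma>) ^ \<beta>))" for x
    unfolding set_lebesgue_integral_def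
    by (rule has_bochner_integral_integral_eq[OF has_bochner_integral_gen_gauss_density_atMost[OF pos]])
  note moment = has_bochner_integral_gen_gauss_density_moment[OF pos, of _ \<theta>]
  have int_lborel: "integrable lborel (\<lambda>x. x ^ n * ?f x)" for n
    using moment by (rule integrable.intros)
  have int: "integrable M (\<lambda>\<omega>. X \<omega> ^ n)" for n
    using distributed_integrable[OF D, of "\<lambda>x. x ^ n"] int_lborel[of n]
    by (simp add: nonneg mult.commute)
  have E_lborel: "expectation (\<lambda>\<omega>. X \<omega> ^ n) = (LBINT x. x ^ n * ?f x)" for n
    using distributed_integral[OF D, of "\<lambda>x. x ^ n"] by (simp add: nonneg mult.commute)
  have E: "expectation (\<lambda>\<omega>. X \<omega> ^ n) = 1 / Gamma (1 / real \<beta>) *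
         (\<Sum>l | 2 * l \<le> n. Gamma ((2 * real l + 1) / real \<beta>) * real (n choose (2 * l)) *
            \<theta> ^ (n - 2 * l) * (\<sigma> / \<eta> powr (1 / real \<beta>)) ^ (2 * l))" for n
    unfolding E_lborel by (rule has_bochner_integral_integral_eq[OF moment])
  have E': "expectation (\<lambda>\<omega>. X \<omega> ^ n) = \<theta> ^ n / Gamma (1 / real \<beta>) *
           (\<Sum>l | 2 * l \<le> n. Gamma ((2 * real l + 1) / real \<beta>) * real (n choose (2 * l)) *
              (\<sigma> / (\<theta> * \<eta> powr (1 / real \<beta>))) ^ (2 * l))" if "\<theta> \<noteq> 0" for n
    unfolding E sum_distrib_left
    by (rule sum.cong) (use that in \<open>auto simp: power_divide power_mult_distrib power_diff\<close>)
  have G: "Gamma (1 / real \<beta>) > 0" using pos by auto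
  have "{l. 2 * l \<le> (1::nat)} = {0}" by auto
  then have E1: "expectation X = \<theta>"
    using E[of 1] G by simp
  have "{l. 2 * l \<le> (2::nat)} = {0, 1}" by auto
  then have E2: "expectation (\<lambda>\<omega>. X \<omega> ^ 2)
      = \<theta>\<^sup>2 + Gamma (3 / real \<beta>) / Gamma (1 / real \<beta>) * (\<sigma> / \<eta> powr (1 / real \<beta>))\<^sup>2"
    using E[of 2] G by (simp add: distrib_left)
  have var: "variance X = expectation (\<lambda>\<omega>. X \<omega> ^ 2) - (expectation X)\<^sup>2"
    using int[of 1] int[of 2] by (intro variance_eq) auto
  have "(\<eta> powr (1 / real \<beta>))\<^sup>2 = \<eta> powr (2 / real \<beta>)"
    using pos by (simp add: powr_power)
  then have var_eq: "variance X = \<sigma> ^ 2 / \<eta> powr (2 / real \<beta>) * (Gamma (3 / real \<beta>) / Gamma (1 / real \<beta>))"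
    using var E1 E2 by (simp add: power_divide mult.commute)
  have var_le: "variance X \<le> \<sigma>\<^sup>2" if "\<eta> \<ge> 1 / 2 \<and> \<beta> > 2"
  proof -
    \<comment> \<open>Parity rules out 3, so 1 / \<beta> \<le> 1 / 4 as the ratio bound
      requires.\<close>
    have "\<beta> \<noteq> 3" using pos(4) by auto
    with that have "\<beta> \<ge> 4" by auto
    then have "1 / \<eta> powr (2 * (1 / real \<beta>)) * (Gamma (3 * (1 / real \<beta>)) / Gamma (1 / real \<beta>)) \<le> 1"
      using that by (intro Gamma_triple_ratio_le_1) (auto simp: field_simps)
    then have "\<sigma>\<^sup>2 * (1 / \<eta> powr (2 / real \<beta>) * (Gamma (3 / real \<beta>) / Gamma (1 / real \<beta>))) \<le> \<sigma>\<^sup>2"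
      by (intro mult_left_le) auto
    then show ?thesis unfolding var_eq by simp
  qed
  note half_2 = gen_gauss_density_half_2[OF pos(2), of \<theta>]
  note var_half_2 = variance_normal_density[OF pos(2), of \<theta>, folded half_2]
  show ?thesis
    by (intro conjI allI impI)
      (rule cdf cdf(2)[unfolded cdf_eq] int int_lborel E_lborel E' E E1 var var_eq var_le half_2 var_half_2,
        assumption?)+
qed

end
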